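(* Let $X$ and $Y$ be finite dimensional complex Hilbert spaces, let $\Gamma$ be a discrete abelian group, and let $\mathcal{G}=(G,\varphi,\theta,\tau)$ be a $\Gamma$-symmetric framework for $X$ and $Y$ with symbol function $\Phi\in C(\hat\Gamma,B(X^{V_0},Y^{E_0}))$. Let $\chi\in\hat\Gamma$ and $a\in X^{V_0}$, and let $z(\chi,a)=(z_v)_{v\in V}\in\ell^\infty(V,X)$ be the bounded vector with components \[z_v=\chi(\gamma)\,d\tau(\gamma)a_{[v]},\quad\text{for } v=\gamma\tilde v,\ \gamma\in\Gamma,\ [v]\in V_0.\] If $a\in\ker\Phi(\chi)$ then $z(\chi,a)\in\ker C(G,\varphi)$.
   Context: Frameworks. A framework for $X$ and $Y$ is a pair $(G,\varphi)$ with $G=(V,E)$ a simple undirected graph and $\varphi=(\varphi_{v,w})_{v,w\in V}$ a family of linear maps $\varphi_{v,w}:X\to Y$ with $\varphi_{v,w}=0$ if $vw\notin E$ and $\varphi_{v,w}=-\varphi_{w,v}$ if $vw\in E$. Throughout $V$ is finite or countably infinite. The coboundary matrix of $(G,\varphi)$ defines the linear map $C(G,\varphi):X^V\to Y^E$, $(x_v)_{v\in V}\mapsto(\varphi_{v,w}(x_v-x_w))_{vw\in E}$. Symmetry. $\Gamma$ is written additively with identity $0$. $\theta:\Gamma\to\mathrm{Aut}(G)$ is a homomorphism; write $\gamma v=\theta(\gamma)v$ and $\gamma e=(\gamma v)(\gamma w)$ for $e=vw$ (in particular $-\gamma v=\theta(-\gamma)v$). Standing assumptions: $\theta$ acts freely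 on vertices and edges ($\gamma v\ne v$, $\gamma e\neq e$ for all $\gamma\ne0$, $v\in V$, $e\in E$), and the sets $V_0$ of vertex orbits $[v]$ and $E_0$ of edge orbits $[e]$ are finite. $\tau:\Gamma\to\mathrm{Isom}(X)$ is a homomorphism into the group of affine isometries of $X$, with $d\tau(\gamma)$ the linear part of $\tau(\gamma)$. $(G,\varphi,\theta,\tau)$ is a $\Gamma$-symmetric framework if $\varphi_{\gamma v,\gamma w}=\varphi_{v,w}\circ d\tau(-\gamma)$ for all $\gamma\in\Gamma$, $v,w\in V$. Gain graph. Choose a representative $\tilde v\in[v]$ for each $[v]\in V_0$. The quotient multigraph has vertex set $V_0$ and edge set $E_0$, $[e]$ joining $[v]$ and $[w]$ if edges in $[e]$ join a vertex of $[v]$ to one of $[w]$; fix an orientation $[e]=([v],[w])$ of each edge. The gain of $[e]=([v],[w])$ is the $\gamma\in\Gamma$ with $\tilde v(\gamma\tilde w)\in[e]$ (for a loop, $[v]=[w]$, this determines $\gamma$ up to sign and one choice is fixed). Put $\tilde e=\tilde v(\gamma\tilde w)\in E$. Every vertex is uniquely $\gamma\tilde v$ and every edge uniquely $\gamma\tilde e$. Symbol function. $S_V:\ell^2(V,X)\to\ell^2(\Gamma,X^{V_0})$, $S_V(z)_\gamma=(z_{\gamma\tilde v})_{[v]}$, and $S_E:\ell^2(E,Y)\to\ell^2(\Gamma,Y^{E_0})$, $S_E(z)_\gamma=(z_{\gamma\tilde e})_{[e]}$. $\tilde\tau(\gamma)(x_{[v]})_{[v]}=(d\tau(\gamma)x_{[v]})_{[v]}$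 on $X^{V_0}$, and $(T_{\tilde\tau}f)(\gamma)=\tilde\tau(-\gamma)f(\gamma)$. $\hat\Gamma$ is the compact dual group with Haar probability measure; $F_H:\ell^2(\Gamma,H)\to L^2(\hat\Gamma,H)$ is the unitary Fourier transform, $\hat f(\chi)=\sum_\gamma\overline{\chi(\gamma)}f(\gamma)$ for $f\in\ell^1(\Gamma,H)$; $(M_\Phi f)(\chi)=\Phi(\chi)f(\chi)$. The symbol function $\Phi$ is the continuous function $\hat\Gamma\to B(X^{V_0},Y^{E_0})$ with $C(G,\varphi)=S_E^{-1}F_{Y^{E_0}}^{-1}M_\Phi F_{X^{V_0}}T_{\tilde\tau}S_V$ as bounded operators $\ell^2(V,X)\to\ell^2(E,Y)$. Explicitly $\Phi(\chi)$ is the matrix (rows $E_0$, columns $V_0$) in which the row of a non-loop directed edge $([v],[w])$ with gain $\gamma$ has $[v]$-entry $\varphi_{\tilde v,\gamma\tilde w}$, $[w]$-entry $\chi(\gamma)\varphi_{\tilde w,-\gamma\tilde v}$ and zeros elsewhere, and the row of a loop $([v],[v])$ with gain $\gamma$ has $[v]$-entry $\varphi_{\tilde v,\gamma\tilde v}+\chi(\gamma)\varphi_{\tilde v,-\gamma\tilde v}$ and zeros elsewhere. *)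

theory Defs
  imports "HOL-Probability.Probability"
begin

section \<open>Finite dimensional complex Hilbert spaces\<close>

text \<open>The complex inner product is linear in its second argument; the real inner product
  (and hence the norm) of the superclass is its real part.\<close>

class complex_hilbert = real_inner + complete_space +
  fixes scaleC :: "complex \<Rightarrow> 'a \<Rightarrow> 'a"  (infixr \<open>*\<^sub>C\<close> 75)
    and cinner :: "'a \<Rightarrow> 'a \<Rightarrow> complex"
  assumes scaleC_add_right: "c *\<^sub>C (x + y) = c *\<^sub>C x + c *\<^sub>C y"
    and scaleC_add_left: "(c + d) *\<^sub>C x = c *\<^sub>C x + d *\<^sub>C x"
    and scaleC_scaleC: "c *\<^sub>C d *\<^sub>C x = (c * d) *\<^sub>C x"
    and scaleR_scaleC: "r *\<^sub>R x = complex_of_real r *\<^sub>C x"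
    and cinner_commute: "cinner x y = cnj (cinner y x)"
    and cinner_add_right: "cinner x (y + z) = cinner x y + cinner x z"
    and cinner_scaleC_right: "cinner x (c *\<^sub>C y) = c * cinner x y"
    and inner_eq_Re_cinner: "inner x y = Re (cinner x y)"

lemma scaleC_one [simp]: "1 *\<^sub>C x = (x :: 'a :: complex_hilbert)"
  using scaleR_scaleC[of 1 x] by simp

interpretation complex_vector: vector_space "scaleC :: complex \<Rightarrow> 'a \<Rightarrow> 'a :: complex_hilbert"
  by unfold_locales (simp_all add: scaleC_add_right scaleC_add_left scaleC_scaleC)

abbreviation clinear :: "('a :: complex_hilbert \<Rightarrow> 'b :: complex_hilbert) \<Rightarrow> bool"
  where "clinear \<equiv> Vector_Spaces.linear scaleC scaleC"

class fin_dim_complex_hilbert = complex_hilbert +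
  assumes finite_dim: "\<exists>B. finite B \<and> (\<forall>x. \<exists>c. x = (\<Sum>b\<in>B. c b *\<^sub>C b))"

lemma norm_scaleC: "norm (c *\<^sub>C x) = cmod c * norm (x :: 'a :: complex_hilbert)"
proof -
  have im: "Im (cinner x x) = 0"
    using cinner_commute[of x x] by (metis Reals_cnj_iff complex_is_Real_iff)
  have l: "cinner (c *\<^sub>C x) y = cnj c * cinner x y" for y
    by (metis cinner_commute cinner_scaleC_right complex_cnj_cnj complex_cnj_mult)
  have "cinner (c *\<^sub>C x) (c *\<^sub>C x) = (c * cnj c) * cinner x x"
    by (simp add: l cinner_scaleC_right)
  also have "\<dots> = complex_of_real ((cmod c)\<^sup>2) * cinner x x"
    by (simp add: complex_norm_square[symmetric])
  finally have "inner (c *\<^sub>C x) (c *\<^sub>C x) = (cmod c)\<^sup>2 * inner x x"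
    by (simp add: inner_eq_Re_cinner im)
  then have "(norm (c *\<^sub>C x))\<^sup>2 = (cmod c * norm x)\<^sup>2"
    by (simp add: power2_norm_eq_inner power_mult_distrib)
  then show ?thesis by (simp add: power2_eq_iff_nonneg)
qed

instance fin_dim_complex_hilbert \<subseteq> second_countable_topology
proof
  obtain B :: "'a set" where B: "finite B" "\<And>x. \<exists>c. x = (\<Sum>b\<in>B. c b *\<^sub>C b)"
    using finite_dim by blast
  define Q where "Q = (\<lambda>p. Complex (fst p) (snd p)) ` (\<rat> \<times> \<rat>)"
  define comb where "comb c = (\<Sum>b\<in>B. c b *\<^sub>C b)" for c :: "'a \<Rightarrow> complex"
  define D where "D = comb ` (B \<rightarrow>\<^sub>E Q)"
  define \<B> where "\<B> = (\<lambda>p. ball (fst p) (inverse (real (Suc (snd p))))) ` (D \<times> UNIV)"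
  have cQ: "countable Q" unfolding Q_def by (intro countable_image countable_SIGMA countable_rat)
  then have cD: "countable D" unfolding D_def by (intro countable_image countable_PiE B(1)) auto
  have c\<B>: "countable \<B>" unfolding \<B>_def using cD by (intro countable_image countable_SIGMA) auto
  have denseQ: "\<exists>q\<in>Q. cmod (c - q) < e" if "e > 0" for c e
  proof -
    obtain a where a: "a \<in> \<rat>" "Re c < a" "a < Re c + e/2"
      using Rats_dense_in_real[of "Re c" "Re c + e/2"] \<open>e > 0\<close> by auto
    obtain b where b: "b \<in> \<rat>" "Im c < b" "b < Im c + e/2"
      using Rats_dense_in_real[of "Im c" "Im c + e/2"] \<open>e > 0\<close> by auto
    have "cmod (c - Complex a b) < e" using cmod_le[of "c - Complex a b"] a b by auto
    then show ?thesis using a b unfolding Q_def by force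
  qed
  have denseD: "\<exists>d\<in>D. dist d x < e" if "e > 0" for e and x :: 'a
  proof -
    obtain c where c: "x = comb c"
      using B(2)[of x] unfolding comb_def by blast
    define K where "K = (\<Sum>b\<in>B. norm b) + 1"
    have "0 \<le> (\<Sum>b\<in>B. norm b)" by (intro sum_nonneg) auto
    then have K: "K > 0" unfolding K_def by simp
    have "\<forall>b. \<exists>q\<in>Q. cmod (c b - q) < e / K" using denseQ \<open>e > 0\<close> K by simp
    then obtain q where q: "\<And>b. q b \<in> Q" "\<And>b. cmod (c b - q b) < e / K" by metis
    let ?q = "restrict q B"
    have "comb ?q - x = (\<Sum>b\<in>B. (q b - c b) *\<^sub>C b)"
      unfolding c comb_def sum_subtractf[symmetric]
      by (intro sum.cong) (simp_all add: complex_vector.scale_left_diff_distrib)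
    also have "norm \<dots> \<le> (\<Sum>b\<in>B. e / K * norm b)"
      by (rule sum_norm_le) (metis norm_scaleC mult_right_mono norm_ge_zero norm_minus_commute less_imp_le q(2))
    also have "\<dots> = e / K * (K - 1)" by (simp add: K_def sum_distrib_left)
    also have "\<dots> < e" using K \<open>e > 0\<close> by (simp add: field_simps)
    finally have "dist (comb ?q) x < e" by (simp add: dist_norm)
    moreover have "comb ?q \<in> D" unfolding D_def using q(1) by auto
    ultimately show ?thesis by blast
  qed
  have "topological_basis \<B>"
  proof (rule topological_basisI)
    show "open U" if "U \<in> \<B>" for U using that unfolding \<B>_def by auto
    show "\<exists>U\<in>\<B>. x \<in> U \<and> U \<subseteq> O'" if O': "open O'" "x \<in> O'" for O' and x :: 'a
    proof -
      obtain e where e: "e > 0" "ball x e \<subseteq> O'" using O' open_contains_ball by blast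
      obtain n where n: "inverse (real (Suc n)) < e/2" using reals_Archimedean[of "e/2"] e by auto
      obtain d where d: "d \<in> D" "dist d x < inverse (real (Suc n))"
        using denseD[of "inverse (real (Suc n))" x] by auto
      have "ball d (inverse (real (Suc n))) \<subseteq> ball x e"
      proof
        fix y assume "y \<in> ball d (inverse (real (Suc n)))"
        then show "y \<in> ball x e"
          using d n dist_triangle[of x y d] by (simp add: dist_commute)
      qed
      moreover have "ball d (inverse (real (Suc n))) \<in> \<B>"
        unfolding \<B>_def using d by (intro image_eqI[of _ _ "(d, n)"]) auto
      moreover have "x \<in> ball d (inverse (real (Suc n)))" using d by simp
      ultimately show ?thesis using e(2) by blast
    qed
  qed
  then have "open = generate_topology \<B>" by (rule topological_basis_imp_subbasis)
  then show "\<exists>B::'a set set. countable B \<and> open = generate_topology B" using c\<B> by blast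
qed

instantiation complex :: fin_dim_complex_hilbert
begin

definition scaleC_complex :: "complex \<Rightarrow> complex \<Rightarrow> complex" where "scaleC_complex c x = c * x"
definition cinner_complex :: "complex \<Rightarrow> complex \<Rightarrow> complex" where "cinner_complex x y = cnj x * y"

instance
proof
  show "\<exists>B. finite B \<and> (\<forall>x::complex. \<exists>c. x = (\<Sum>b\<in>B. c b *\<^sub>C b))"
    by (rule exI[of _ "{1}"]) (auto simp: scaleC_complex_def intro: exI[of _ "\<lambda>_. x" for x])
qed (auto simp: scaleC_complex_def cinner_complex_def algebra_simps scaleR_conv_of_real
       inner_complex_def)

end

section \<open>Frameworks\<close>

text \<open>An edge is the two-element set of its end vertices.\<close>

locale framework =
  fixes V :: "'v set" and E :: "'v set set"
    and \<phi> :: "'v \<Rightarrow> 'v \<Rightarrow> 'x :: fin_dim_complex_hilbert \<Rightarrow> 'y :: fin_dim_complex_hilbert"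
  assumes countable_V: "countable V"
    and edge: "e \<in> E \<Longrightarrow> \<exists>v\<in>V. \<exists>w\<in>V. v \<noteq> w \<and> e = {v, w}"
    and phi_linear: "v \<in> V \<Longrightarrow> w \<in> V \<Longrightarrow> clinear (\<phi> v w)"
    and phi_nonedge: "v \<in> V \<Longrightarrow> w \<in> V \<Longrightarrow> {v, w} \<notin> E \<Longrightarrow> \<phi> v w = (\<lambda>_. 0)"
    and phi_edge: "{v, w} \<in> E \<Longrightarrow> \<phi> v w = (\<lambda>x. - \<phi> w v x)"

definition coboundary ::
    "('v \<Rightarrow> 'v \<Rightarrow> 'x :: complex_hilbert \<Rightarrow> 'y :: complex_hilbert) \<Rightarrow> ('v \<Rightarrow> 'x) \<Rightarrow> 'v set \<Rightarrow> 'y" where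
  "coboundary \<phi> x e = (THE y. \<exists>v w. e = {v, w} \<and> y = \<phi> v w (x v - x w))"

lemma (in framework) coboundary_edge:
  assumes "{v, w} \<in> E"
  shows "coboundary \<phi> x {v, w} = \<phi> v w (x v - x w)"
proof -
  obtain v' w' where "v' \<in> V" "w' \<in> V" "{v, w} = {v', w'}" using edge[OF assms] by blast
  then have "v \<in> V" "w \<in> V" by (auto simp: doubleton_eq_iff)
  then have l: "clinear (\<phi> v w)" by (rule phi_linear)
  have "- \<phi> v w (x w - x v) = \<phi> v w (x v - x w)"
    using module_hom.neg[OF l[unfolded linear_iff_module_hom], of "x w - x v"] by simp
  moreover have "\<phi> w v = (\<lambda>x. - \<phi> v w x)" using assms phi_edge[of w v] by (simp add: insert_commute)
  ultimately have "\<phi> w v (x w - x v) = \<phi> v w (x v - x w)" by simp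
  then show ?thesis unfolding coboundary_def
    by (intro the_equality) (auto simp: doubleton_eq_iff)
qed

section \<open>Symmetric frameworks\<close>

definition linear_part :: "('x :: complex_hilbert \<Rightarrow> 'x) \<Rightarrow> 'x \<Rightarrow> 'x" where
  "linear_part T x = T x - T 0"

definition affine_isometry :: "('x :: complex_hilbert \<Rightarrow> 'x) \<Rightarrow> bool" where
  "affine_isometry T \<longleftrightarrow>
     clinear (linear_part T) \<and> (\<forall>x y. dist (T x) (T y) = dist x y) \<and> surj T"

definition vorbit :: "('g \<Rightarrow> 'v \<Rightarrow> 'v) \<Rightarrow> 'v \<Rightarrow> 'v set" where
  "vorbit \<theta> v = range (\<lambda>\<gamma>. \<theta> \<gamma> v)"

definition eorbit :: "('g \<Rightarrow> 'v \<Rightarrow> 'v) \<Rightarrow> 'v set \<Rightarrow> 'v set set" where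
  "eorbit \<theta> e = range (\<lambda>\<gamma>. \<theta> \<gamma> ` e)"

definition vorbits :: "('g \<Rightarrow> 'v \<Rightarrow> 'v) \<Rightarrow> 'v set \<Rightarrow> 'v set set" where
  "vorbits \<theta> V = vorbit \<theta> ` V"

definition eorbits :: "('g \<Rightarrow> 'v \<Rightarrow> 'v) \<Rightarrow> 'v set set \<Rightarrow> 'v set set set" where
  "eorbits \<theta> E = eorbit \<theta> ` E"

locale symmetric_framework = framework V E \<phi>
  for V :: "'v set" and E :: "'v set set"
    and \<phi> :: "'v \<Rightarrow> 'v \<Rightarrow> 'x :: fin_dim_complex_hilbert \<Rightarrow> 'y :: fin_dim_complex_hilbert" +
  fixes \<theta> :: "'g :: ab_group_add \<Rightarrow> 'v \<Rightarrow> 'v"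
    and \<tau> :: "'g \<Rightarrow> 'x \<Rightarrow> 'x"
  assumes theta_bij: "bij_betw (\<theta> \<gamma>) V V"
    and theta_edge: "v \<in> V \<Longrightarrow> w \<in> V \<Longrightarrow> {\<theta> \<gamma> v, \<theta> \<gamma> w} \<in> E \<longleftrightarrow> {v, w} \<in> E"
    and theta_add: "v \<in> V \<Longrightarrow> \<theta> (\<gamma> + \<delta>) v = \<theta> \<gamma> (\<theta> \<delta> v)"
    and free_vertices: "v \<in> V \<Longrightarrow> \<gamma> \<noteq> 0 \<Longrightarrow> \<theta> \<gamma> v \<noteq> v"
    and free_edges: "e \<in> E \<Longrightarrow> \<gamma> \<noteq> 0 \<Longrightarrow> \<theta> \<gamma> ` e \<noteq> e"
    and finite_vorbits: "finite (vorbits \<theta> V)"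
    and finite_eorbits: "finite (eorbits \<theta> E)"
    and tau_isometry: "affine_isometry (\<tau> \<gamma>)"
    and tau_add: "\<tau> (\<gamma> + \<delta>) = \<tau> \<gamma> \<circ> \<tau> \<delta>"
    and phi_equivariant: "v \<in> V \<Longrightarrow> w \<in> V \<Longrightarrow>
      \<phi> (\<theta> \<gamma> v) (\<theta> \<gamma> w) = \<phi> v w \<circ> linear_part (\<tau> (- \<gamma>))"

text \<open>The gain graph: \<open>r\<close> picks the vertex representatives, \<open>src\<close> and \<open>tgt\<close> give the
  orientation of the edge orbits, and \<open>gain\<close> their gains. For a non-loop the requirement
  below determines the gain; for a loop it determines it up to sign.\<close>

definition rep_edge ::
    "('g \<Rightarrow> 'v \<Rightarrow> 'v) \<Rightarrow> ('v set \<Rightarrow> 'v) \<Rightarrow> ('v set set \<Rightarrow> 'v set) \<Rightarrow> ('v set set \<Rightarrow> 'v set) \<Rightarrow>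
     ('v set set \<Rightarrow> 'g) \<Rightarrow> 'v set set \<Rightarrow> 'v set" where
  "rep_edge \<theta> r src tgt gain p = {r (src p), \<theta> (gain p) (r (tgt p))}"

locale symmetric_framework_with_gains = symmetric_framework V E \<phi> \<theta> \<tau>
  for V :: "'v set" and E :: "'v set set"
    and \<phi> :: "'v \<Rightarrow> 'v \<Rightarrow> 'x :: fin_dim_complex_hilbert \<Rightarrow> 'y :: fin_dim_complex_hilbert"
    and \<theta> :: "'g :: ab_group_add \<Rightarrow> 'v \<Rightarrow> 'v" and \<tau> :: "'g \<Rightarrow> 'x \<Rightarrow> 'x" +
  fixes r :: "'v set \<Rightarrow> 'v"
    and src tgt :: "'v set set \<Rightarrow> 'v set"
    and gain :: "'v set set \<Rightarrow> 'g"
  assumes rep_in: "q \<in> vorbits \<theta> V \<Longrightarrow> r q \<in> q"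
    and src_in: "p \<in> eorbits \<theta> E \<Longrightarrow> src p \<in> vorbits \<theta> V"
    and tgt_in: "p \<in> eorbits \<theta> E \<Longrightarrow> tgt p \<in> vorbits \<theta> V"
    and rep_edge_in: "p \<in> eorbits \<theta> E \<Longrightarrow> rep_edge \<theta> r src tgt gain p \<in> p"

section \<open>Dual group and Fourier transform\<close>

text \<open>The dual of the discrete group \<open>'g\<close>, as a subspace of the product space
  \<open>'g \<Rightarrow> complex\<close> (topology of pointwise convergence).\<close>

definition dual_group :: "('g :: ab_group_add \<Rightarrow> complex) set" where
  "dual_group = {\<xi>. (\<forall>\<gamma>. cmod (\<xi> \<gamma>) = 1) \<and> (\<forall>\<gamma> \<delta>. \<xi> (\<gamma> + \<delta>) = \<xi> \<gamma> * \<xi> \<delta>)}"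

definition haar_prob_dual :: "('g :: ab_group_add \<Rightarrow> complex) measure \<Rightarrow> bool" where
  "haar_prob_dual \<mu> \<longleftrightarrow> prob_space \<mu> \<and> sets \<mu> = sets (restrict_space borel dual_group) \<and>
     (\<forall>\<xi>\<in>dual_group. distr \<mu> \<mu> (\<lambda>\<psi> \<gamma>. \<xi> \<gamma> * \<psi> \<gamma>) = \<mu>)"

text \<open>A finite direct sum \<open>H\<^sup>I\<close> is represented by functions on the index type, of which
  only the values on \<open>I\<close> matter; its norm is the \<open>L2_set\<close> norm. \<open>has_fourier \<mu> I f g\<close> says
  that \<open>g\<close> represents the transform of \<open>f \<in> \<ell>\<^sup>2(\<Gamma>, H\<^sup>I)\<close>, i.e. that the sum over \<open>\<gamma>\<close> of
  \<open>cnj (\<xi> \<gamma>) f \<gamma>\<close> converges unconditionally to \<open>g\<close> in the mean square. This is the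
  continuous extension to \<open>\<ell>\<^sup>2\<close> of the formula on \<open>\<ell>\<^sup>1\<close>.\<close>

definition has_fourier ::
    "('g :: ab_group_add \<Rightarrow> complex) measure \<Rightarrow> 'i set \<Rightarrow>
     ('g \<Rightarrow> 'i \<Rightarrow> 'h :: complex_hilbert) \<Rightarrow> (('g \<Rightarrow> complex) \<Rightarrow> 'i \<Rightarrow> 'h) \<Rightarrow> bool" where
  "has_fourier \<mu> I f g \<longleftrightarrow>
     (\<forall>i\<in>I. (\<lambda>\<xi>. g \<xi> i) \<in> borel_measurable \<mu>) \<and>
     ((\<lambda>F. \<integral>\<^sup>+\<xi>. ennreal ((L2_set (\<lambda>i. norm (g \<xi> i - (\<Sum>\<gamma>\<in>F. cnj (\<xi> \<gamma>) *\<^sub>C f \<gamma> i))) I)\<^sup>2) \<partial>\<mu>)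
        \<longlongrightarrow> 0) (finite_subsets_at_top UNIV)"

definition fourier ::
    "('g :: ab_group_add \<Rightarrow> complex) measure \<Rightarrow> 'i set \<Rightarrow>
     ('g \<Rightarrow> 'i \<Rightarrow> 'h :: complex_hilbert) \<Rightarrow> ('g \<Rightarrow> complex) \<Rightarrow> 'i \<Rightarrow> 'h" where
  "fourier \<mu> I f = (SOME g. has_fourier \<mu> I f g)"

section \<open>Symbol function\<close>

definition S_V :: "('g \<Rightarrow> 'v \<Rightarrow> 'v) \<Rightarrow> ('v set \<Rightarrow> 'v) \<Rightarrow> ('v \<Rightarrow> 'x) \<Rightarrow> 'g \<Rightarrow> 'v set \<Rightarrow> 'x" where
  "S_V \<theta> r z \<gamma> q = z (\<theta> \<gamma> (r q))"

definition S_E ::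
    "('g \<Rightarrow> 'v \<Rightarrow> 'v) \<Rightarrow> ('v set set \<Rightarrow> 'v set) \<Rightarrow> ('v set \<Rightarrow> 'y) \<Rightarrow> 'g \<Rightarrow> 'v set set \<Rightarrow> 'y" where
  "S_E \<theta> rep z \<gamma> p = z (\<theta> \<gamma> ` rep p)"

definition T_tau ::
    "('g :: ab_group_add \<Rightarrow> 'x :: complex_hilbert \<Rightarrow> 'x) \<Rightarrow> ('g \<Rightarrow> 'i \<Rightarrow> 'x) \<Rightarrow> 'g \<Rightarrow> 'i \<Rightarrow> 'x" where
  "T_tau \<tau> f \<gamma> q = linear_part (\<tau> (- \<gamma>)) (f \<gamma> q)"

text \<open>\<open>B(X\<^sup>I, Y\<^sup>J)\<close> for finite \<open>I\<close>, \<open>J\<close> and finite dimensional \<open>X\<close>, so that boundedness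
  is automatic.\<close>

definition sum_operator ::
    "'i set \<Rightarrow> 'j set \<Rightarrow>
     (('i \<Rightarrow> 'x :: complex_hilbert) \<Rightarrow> 'j \<Rightarrow> 'y :: complex_hilbert) \<Rightarrow> bool" where
  "sum_operator I J T \<longleftrightarrow>
     (\<forall>a b. (\<forall>i\<in>I. a i = b i) \<longrightarrow> (\<forall>j\<in>J. T a j = T b j)) \<and>
     (\<forall>a b. \<forall>j\<in>J. T (\<lambda>i. a i + b i) j = T a j + T b j) \<and>
     (\<forall>c a. \<forall>j\<in>J. T (\<lambda>i. c *\<^sub>C a i) j = c *\<^sub>C T a j)"

text \<open>The second conjunct is continuity in operator norm. The third is
  \<open>F S\<^sub>E C(G,\<phi>) z = M\<^sub>\<Phi> F T S\<^sub>V z\<close> in \<open>L\<^sup>2\<close> for all \<open>z \<in> \<ell>\<^sup>2(V,X)\<close>, i.e. the defining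
  factorisation with the unitaries \<open>S\<^sub>E\<close> and \<open>F\<close> moved to the other side.\<close>

definition is_symbol_function ::
    "'v set \<Rightarrow> 'v set set \<Rightarrow>
     ('v \<Rightarrow> 'v \<Rightarrow> 'x :: fin_dim_complex_hilbert \<Rightarrow> 'y :: fin_dim_complex_hilbert) \<Rightarrow>
     ('g :: ab_group_add \<Rightarrow> 'v \<Rightarrow> 'v) \<Rightarrow> ('g \<Rightarrow> 'x \<Rightarrow> 'x) \<Rightarrow>
     ('v set \<Rightarrow> 'v) \<Rightarrow> ('v set set \<Rightarrow> 'v set) \<Rightarrow> ('v set set \<Rightarrow> 'v set) \<Rightarrow> ('v set set \<Rightarrow> 'g) \<Rightarrow>
     ('g \<Rightarrow> complex) measure \<Rightarrow>
     (('g \<Rightarrow> complex) \<Rightarrow> ('v set \<Rightarrow> 'x) \<Rightarrow> 'v set set \<Rightarrow> 'y) \<Rightarrow> bool" where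
  "is_symbol_function V E \<phi> \<theta> \<tau> r src tgt gain \<mu> \<Phi> \<longleftrightarrow>
     (\<forall>\<xi>\<in>dual_group. sum_operator (vorbits \<theta> V) (eorbits \<theta> E) (\<Phi> \<xi>)) \<and>
     (\<forall>\<xi>\<in>dual_group. \<forall>\<epsilon>>0. \<forall>\<^sub>F \<psi> in at \<xi> within dual_group. \<forall>a.
        L2_set (\<lambda>p. norm (\<Phi> \<psi> a p - \<Phi> \<xi> a p)) (eorbits \<theta> E)
          \<le> \<epsilon> * L2_set (\<lambda>q. norm (a q)) (vorbits \<theta> V)) \<and>
     (\<forall>z. (\<lambda>v. (norm (z v))\<^sup>2) summable_on V \<longrightarrow>
        (AE \<xi> in \<mu>. \<forall>p\<in>eorbits \<theta> E.
           fourier \<mu> (eorbits \<theta> E) (S_E \<theta> (rep_edge \<theta> r src tgt gain) (coboundary \<phi> z)) \<xi> p =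
           \<Phi> \<xi> (fourier \<mu> (vorbits \<theta> V) (T_tau \<tau> (S_V \<theta> r z)) \<xi>) p))"

section \<open>The bounded vector associated with a character\<close>

definition character_vector ::
    "('g :: ab_group_add \<Rightarrow> 'v \<Rightarrow> 'v) \<Rightarrow> ('g \<Rightarrow> 'x :: complex_hilbert \<Rightarrow> 'x) \<Rightarrow> ('v set \<Rightarrow> 'v) \<Rightarrow>
     ('g \<Rightarrow> complex) \<Rightarrow> ('v set \<Rightarrow> 'x) \<Rightarrow> 'v \<Rightarrow> 'x" where
  "character_vector \<theta> \<tau> r \<xi> a v =
     (let q = vorbit \<theta> v; \<gamma> = (THE \<gamma>. v = \<theta> \<gamma> (r q))
      in \<xi> \<gamma> *\<^sub>C linear_part (\<tau> \<gamma>) (a q))"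

lemma (in symmetric_framework_with_gains) character_vector_rep:
  assumes q: "q \<in> vorbits \<theta> V"
  shows "character_vector \<theta> \<tau> r \<xi> a (\<theta> \<gamma> (r q)) = \<xi> \<gamma> *\<^sub>C linear_part (\<tau> \<gamma>) (a q)"
proof -
  obtain v where v: "v \<in> V" "q = vorbit \<theta> v" using q unfolding vorbits_def by blast
  obtain \<delta> where \<delta>: "r q = \<theta> \<delta> v" using rep_in[OF q] v unfolding vorbit_def by blast
  have inV: "\<theta> \<alpha> u \<in> V" if "u \<in> V" for \<alpha> u using theta_bij[of \<alpha>] that by (auto dest: bij_betwE)
  have act: "\<theta> \<gamma> (r q) = \<theta> (\<gamma> + \<delta>) v" for \<gamma> by (simp add: \<delta> theta_add[OF v(1)])
  have "vorbit \<theta> (\<theta> \<alpha> v) = vorbit \<theta> v" for \<alpha>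
  proof -
    have "\<theta> \<beta> v \<in> vorbit \<theta> (\<theta> \<alpha> v)" for \<beta>
      using theta_add[OF v(1), of "\<beta> - \<alpha>" \<alpha>] unfolding vorbit_def by auto
    moreover have "\<theta> \<beta> (\<theta> \<alpha> v) \<in> vorbit \<theta> v" for \<beta>
      using theta_add[OF v(1), of \<beta> \<alpha>] unfolding vorbit_def by (metis rangeI)
    ultimately show ?thesis unfolding vorbit_def by blast
  qed
  then have orb: "vorbit \<theta> (\<theta> \<gamma> (r q)) = q" unfolding act using v(2) by simp
  have uniq: "\<alpha> = \<beta>" if eq: "\<theta> \<alpha> v = \<theta> \<beta> v" for \<alpha> \<beta>
  proof (rule ccontr)
    assume "\<alpha> \<noteq> \<beta>"
    moreover have "\<theta> (\<alpha> - \<beta>) (\<theta> \<beta> v) = \<theta> \<beta> v"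
      using eq theta_add[OF v(1), of "\<alpha> - \<beta>" \<beta>] by simp
    ultimately show False using free_vertices[OF inV[OF v(1)], of "\<alpha> - \<beta>" \<beta>] by simp
  qed
  have "(THE \<gamma>'. \<theta> \<gamma> (r q) = \<theta> \<gamma>' (r q)) = \<gamma>"
  proof (intro the_equality refl)
    fix \<gamma>' assume "\<theta> \<gamma> (r q) = \<theta> \<gamma>' (r q)"
    then have "\<gamma> + \<delta> = \<gamma>' + \<delta>" unfolding act by (rule uniq)
    then show "\<gamma>' = \<gamma>" by simp
  qed
  then show ?thesis unfolding character_vector_def orb by simp
qed

end

theory Submission
  imports Defs
begin

text \<open>
  The vector \<open>z = z(\<xi>, a)\<close> satisfies \<open>z (\<gamma> v) = \<xi> \<gamma> d\<tau>(\<gamma>) (z v)\<close>. By equivariance of \<open>\<phi>\<close> its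
  coboundary on \<open>\<gamma> e\<close>, where \<open>e\<close> is the representative of the edge orbit \<open>p\<close>, is therefore \<open>\<xi> \<gamma>\<close>
  times a vector \<open>symbol_row \<xi> a p\<close> that does not depend on \<open>\<gamma>\<close>
  (\<open>coboundary_character_vector\<close>). The kernel statement follows once
  \<open>\<Phi> \<xi> a p = symbol_row \<xi> a p\<close> is known (\<open>symbol_function_eq_symbol_row\<close>).

  The symbol function is only characterised by a factorisation in the mean square sense, and the
  formula for it has to be recovered at a single character. To this end the factorisation is
  applied to the finitely supported vector that equals \<open>a\<close> at the vertex representatives. On one
  side its transform is the constant function \<open>a\<close>; on the other side the coboundary is finitely
  supported too, and its transform is the trigonometric polynomial \<open>\<xi> \<mapsto> symbol_row \<xi> a p\<close>. As
  Fourier transforms are unique up to null sets (\<open>has_fourier_unique\<close>), the formula holds for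
  almost every \<open>\<xi>\<close>. Both sides are continuous in \<open>\<xi>\<close>, and a null set of Haar measure contains no
  nonempty open set (\<open>haar_open_null_empty\<close>), so the formula holds everywhere.
\<close>

section \<open>Linear maps between complex Hilbert spaces\<close>

lemma clinear_simps:
  assumes "clinear f"
  shows "f (x + y) = f x + f y" "f (x - y) = f x - f y" "f (- x) = - f x" "f 0 = 0"
    "f (c *\<^sub>C x) = c *\<^sub>C f x"
proof -
  interpret f: module_hom scaleC scaleC f
    using assms by (simp add: linear_iff_module_hom)
  show "f (x + y) = f x + f y" "f (x - y) = f x - f y" "f (- x) = - f x" "f 0 = 0"
    "f (c *\<^sub>C x) = c *\<^sub>C f x"
    by (simp_all add: f.add f.diff f.neg f.scale)
qed

lemma bounded_linear_scaleC_left: "bounded_linear (\<lambda>c. c *\<^sub>C (x :: 'a :: complex_hilbert))"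
proof (rule bounded_linear_intro)
  show "(c + d) *\<^sub>C x = c *\<^sub>C x + d *\<^sub>C x" for c d by (rule scaleC_add_left)
  show "(t *\<^sub>R c) *\<^sub>C x = t *\<^sub>R c *\<^sub>C x" for t c
    by (simp only: scaleR_conv_of_real scaleR_scaleC[of t "c *\<^sub>C x"] scaleC_scaleC)
  show "norm (c *\<^sub>C x) \<le> norm c * norm x" for c by (simp add: norm_scaleC)
qed

lemma continuous_on_scaleC_left:
  "continuous_on S f \<Longrightarrow> continuous_on S (\<lambda>\<xi>. f \<xi> *\<^sub>C (x :: 'a :: complex_hilbert))"
  by (rule bounded_linear.continuous_on[OF bounded_linear_scaleC_left])

lemma clinear_linear_part:
  assumes "affine_isometry T"
  shows "clinear (linear_part T)"
  using assms by (simp add: affine_isometry_def)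

lemma norm_linear_part:
  assumes "affine_isometry T"
  shows "norm (linear_part T x) = norm x"
proof -
  have "dist (T x) (T 0) = dist x 0" using assms by (simp add: affine_isometry_def)
  then show ?thesis by (simp add: linear_part_def dist_norm)
qed

lemma linear_part_comp:
  assumes "affine_isometry S"
  shows "linear_part (S \<circ> T) x = linear_part S (linear_part T x)"
proof -
  have "linear_part S (linear_part T x) = linear_part S (T x) - linear_part S (T 0)"
    unfolding linear_part_def[of T] by (rule clinear_simps(2)[OF clinear_linear_part[OF assms]])
  then show ?thesis by (simp add: linear_part_def)
qed

section \<open>The compact dual group and its Haar measure\<close>

lemma dual_group_zero: "\<xi> \<in> dual_group \<Longrightarrow> \<xi> 0 = 1"
proof -
  assume "\<xi> \<in> dual_group"
  then have "\<xi> (0 + 0) = \<xi> 0 * \<xi> 0" "cmod (\<xi> 0) = 1"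
    unfolding dual_group_def by blast+
  then show ?thesis by (metis mult_cancel_left1 norm_zero zero_neq_one add_0)
qed

lemma dual_group_add: "\<xi> \<in> dual_group \<Longrightarrow> \<xi> (\<gamma> + \<delta>) = \<xi> \<gamma> * \<xi> \<delta>"
  by (simp add: dual_group_def)

lemma dual_group_norm: "\<xi> \<in> dual_group \<Longrightarrow> cmod (\<xi> \<gamma>) = 1"
  by (simp add: dual_group_def)

lemma dual_group_cnj_mult: "\<xi> \<in> dual_group \<Longrightarrow> cnj (\<xi> \<gamma>) * \<xi> \<gamma> = 1"
  using complex_norm_square[of "\<xi> \<gamma>"] by (simp add: dual_group_norm mult.commute)

lemma dual_group_uminus:
  assumes "\<xi> \<in> dual_group"
  shows "\<xi> (- \<gamma>) = cnj (\<xi> \<gamma>)"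
proof -
  have "\<xi> (- \<gamma>) * \<xi> \<gamma> = cnj (\<xi> \<gamma>) * \<xi> \<gamma>"
    using dual_group_add[OF assms, of "- \<gamma>" \<gamma>]
    by (simp add: dual_group_zero[OF assms] dual_group_cnj_mult[OF assms])
  moreover have "\<xi> \<gamma> \<noteq> 0" using dual_group_norm[OF assms, of \<gamma>] by auto
  ultimately show ?thesis by simp
qed

lemma dual_group_mult: "\<xi> \<in> dual_group \<Longrightarrow> \<psi> \<in> dual_group \<Longrightarrow> (\<lambda>\<gamma>. \<xi> \<gamma> * \<psi> \<gamma>) \<in> dual_group"
  by (simp add: dual_group_def norm_mult algebra_simps)

lemma dual_group_cnj: "\<xi> \<in> dual_group \<Longrightarrow> (\<lambda>\<gamma>. cnj (\<xi> \<gamma>)) \<in> dual_group"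
  by (simp add: dual_group_def)

lemma continuous_on_eval: "continuous_on S (\<lambda>\<xi> :: 'g \<Rightarrow> complex. \<xi> \<gamma>)"
  by (rule continuous_on_subset[OF continuous_on_product_coordinates]) simp

text \<open>The dual group is cut out by closed conditions from a product of circles, so
  Tychonoff's theorem applies.\<close>

lemma compact_dual_group: "compact (dual_group :: ('g :: ab_group_add \<Rightarrow> complex) set)"
proof -
  let ?P = "PiE UNIV (\<lambda>_. sphere 0 1) :: ('g \<Rightarrow> complex) set"
  let ?H = "\<Inter>\<gamma>. \<Inter>\<delta>. {\<xi> :: 'g \<Rightarrow> complex. \<xi> (\<gamma> + \<delta>) = \<xi> \<gamma> * \<xi> \<delta>}"
  have "compactin (product_topology (\<lambda>_::'g. euclidean) UNIV) ?P"
    unfolding compactin_PiE by simp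
  then have P: "compact ?P" unfolding euclidean_product_topology by simp
  have "closed {\<xi> :: 'g \<Rightarrow> complex. \<xi> (\<gamma> + \<delta>) = \<xi> \<gamma> * \<xi> \<delta>}" for \<gamma> \<delta>
    by (intro closed_Collect_eq continuous_on_mult continuous_on_eval)
  then have H: "closed ?H" by (intro closed_INT ballI)
  have "(\<xi> \<in> dual_group) = (\<xi> \<in> ?P \<inter> ?H)" for \<xi> :: "'g \<Rightarrow> complex"
    by (simp add: dual_group_def PiE_UNIV_domain Pi_iff)
  then have "dual_group = ?P \<inter> ?H" by (rule set_eqI)
  then show ?thesis using compact_Int_closed[OF P H] by (simp only:)
qed

lemma haar_space:
  assumes "haar_prob_dual \<mu>"
  shows "space \<mu> = dual_group"
  using assms sets_eq_imp_space_eq[of \<mu> "restrict_space borel dual_group"]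
  by (simp add: haar_prob_dual_def space_restrict_space)

lemma continuous_on_dual_group_measurable:
  assumes "haar_prob_dual \<mu>" and "continuous_on dual_group f"
  shows "f \<in> borel_measurable \<mu>"
  using borel_measurable_continuous_on_restrict[OF assms(2)] assms(1)
  by (simp add: haar_prob_dual_def cong: measurable_cong_sets)

lemma measurable_translation:
  assumes \<mu>: "haar_prob_dual \<mu>" and \<xi>: "\<xi> \<in> dual_group"
  shows "(\<lambda>\<psi> \<gamma>. \<xi> \<gamma> * \<psi> \<gamma>) \<in> measurable \<mu> \<mu>"
proof -
  have "continuous_on dual_group (\<lambda>\<psi> \<gamma>. \<xi> \<gamma> * \<psi> \<gamma>)"
    by (intro continuous_on_coordinatewise_then_product continuous_on_mult continuous_on_const
        continuous_on_eval)
  then have "(\<lambda>\<psi> \<gamma>. \<xi> \<gamma> * \<psi> \<gamma>) \<in> borel_measurable \<mu>"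
    by (rule continuous_on_dual_group_measurable[OF \<mu>])
  then have "(\<lambda>\<psi> \<gamma>. \<xi> \<gamma> * \<psi> \<gamma>) \<in> measurable \<mu> (restrict_space borel dual_group)"
    by (intro measurable_restrict_space2) (auto simp: haar_space[OF \<mu>] dual_group_mult[OF \<xi>])
  then show ?thesis using \<mu> by (simp add: haar_prob_dual_def cong: measurable_cong_sets)
qed

text \<open>Haar measure has full support: the translates of a nonempty open set cover the group,
  by compactness finitely many of them do, and all of them have the same measure.\<close>

lemma haar_open_null_empty:
  fixes \<mu> :: "('g :: ab_group_add \<Rightarrow> complex) measure"
  assumes \<mu>: "haar_prob_dual \<mu>" and "open U" and null: "AE \<psi> in \<mu>. \<psi> \<notin> U"
  shows "U \<inter> dual_group = {}"
proof (rule ccontr)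
  assume "U \<inter> dual_group \<noteq> {}"
  then obtain \<eta> where \<eta>: "\<eta> \<in> U" "\<eta> \<in> dual_group" by blast
  define W where "W \<xi> = {\<psi> :: 'g \<Rightarrow> complex. (\<lambda>\<gamma>. \<xi> \<gamma> * \<psi> \<gamma>) \<in> U}" for \<xi> :: "'g \<Rightarrow> complex"
  have openW: "open (W \<xi>)" for \<xi>
  proof -
    have "continuous_on UNIV (\<lambda>\<psi> \<gamma>. \<xi> \<gamma> * \<psi> \<gamma>)"
      by (intro continuous_on_coordinatewise_then_product continuous_on_mult continuous_on_const
        continuous_on_eval)
    from open_vimage[OF \<open>open U\<close> this] show ?thesis by (simp add: W_def vimage_def)
  qed
  have nullW: "AE \<psi> in \<mu>. \<psi> \<notin> W \<xi>" if \<xi>: "\<xi> \<in> dual_group" for \<xi>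
  proof -
    have "AE \<psi> in distr \<mu> \<mu> (\<lambda>\<psi> \<gamma>. \<xi> \<gamma> * \<psi> \<gamma>). \<psi> \<notin> U"
      using \<mu> \<xi> null unfolding haar_prob_dual_def by metis
    from AE_distrD[OF measurable_translation[OF \<mu> \<xi>] this] show ?thesis by (simp add: W_def)
  qed
  have cover: "dual_group \<subseteq> \<Union> (W ` dual_group)"
  proof
    fix \<psi> :: "'g \<Rightarrow> complex" assume \<psi>: "\<psi> \<in> dual_group"
    have "(\<lambda>\<gamma>. \<eta> \<gamma> * cnj (\<psi> \<gamma>)) \<in> dual_group"
      by (intro dual_group_mult dual_group_cnj \<eta> \<psi>)
    moreover have "\<psi> \<in> W (\<lambda>\<gamma>. \<eta> \<gamma> * cnj (\<psi> \<gamma>))"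
      using \<eta>(1) by (simp add: W_def mult.assoc dual_group_cnj_mult[OF \<psi>])
    ultimately show "\<psi> \<in> \<Union> (W ` dual_group)" by blast
  qed
  \<comment> \<open>Finitely many null sets would cover the whole space of the probability measure.\<close>
  obtain K where K: "K \<subseteq> dual_group" "finite K" "dual_group \<subseteq> \<Union> (W ` K)"
    using compactE_image[OF compact_dual_group, of dual_group W] openW cover by metis
  have "AE \<psi> in \<mu>. \<forall>\<xi>\<in>K. \<psi> \<notin> W \<xi>" using K nullW by (intro AE_finite_allI) auto
  moreover have "AE \<psi> in \<mu>. \<psi> \<in> dual_group" using haar_space[OF \<mu>] AE_space[of \<mu>] by simp
  ultimately have "AE \<psi> in \<mu>. False" by eventually_elim (use K(3) in blast)
  then show False
    using \<mu> prob_space.AE_False[of \<mu>] by (simp add: haar_prob_dual_def)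
qed

lemma continuous_AE_eq_imp_eq:
  fixes f g :: "('g :: ab_group_add \<Rightarrow> complex) \<Rightarrow> 'a :: real_normed_vector"
  assumes \<mu>: "haar_prob_dual \<mu>"
    and "continuous_on dual_group f" "continuous_on dual_group g"
    and ae: "AE \<psi> in \<mu>. f \<psi> = g \<psi>" and \<xi>: "\<xi> \<in> dual_group"
  shows "f \<xi> = g \<xi>"
proof -
  have "continuous_on dual_group (\<lambda>\<psi>. f \<psi> - g \<psi>)" by (intro continuous_on_diff assms)
  then obtain U where U: "open U" "U \<inter> dual_group = (\<lambda>\<psi>. f \<psi> - g \<psi>) -` (- {0}) \<inter> dual_group"
    unfolding continuous_on_open_invariant by (metis open_Compl closed_singleton)
  have "AE \<psi> in \<mu>. \<psi> \<in> dual_group" using haar_space[OF \<mu>] AE_space[of \<mu>] by simp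
  with ae have "AE \<psi> in \<mu>. \<psi> \<notin> U" by eventually_elim (use U(2) in auto)
  from haar_open_null_empty[OF \<mu> U(1) this] U(2) \<xi> show ?thesis by auto
qed

section \<open>The Fourier transform\<close>

lemma continuous_on_trig_polynomial:
  "continuous_on S (\<lambda>\<xi>. \<Sum>\<gamma>\<in>F. cnj (\<xi> \<gamma>) *\<^sub>C (c \<gamma> :: 'h :: complex_hilbert))"
  by (intro continuous_on_sum continuous_on_scaleC_left continuous_on_cnj continuous_on_eval)

lemma has_fourier_finite_support:
  assumes "haar_prob_dual \<mu>" and "finite K" and "\<And>i \<gamma>. i \<in> I \<Longrightarrow> \<gamma> \<notin> K \<Longrightarrow> f \<gamma> i = 0"
  shows "has_fourier \<mu> I f (\<lambda>\<xi> i. \<Sum>\<gamma>\<in>K. cnj (\<xi> \<gamma>) *\<^sub>C f \<gamma> i)"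
  unfolding has_fourier_def
proof (intro conjI ballI)
  fix i
  show "(\<lambda>\<xi>. \<Sum>\<gamma>\<in>K. cnj (\<xi> \<gamma>) *\<^sub>C f \<gamma> i) \<in> borel_measurable \<mu>"
    by (intro continuous_on_dual_group_measurable[OF assms(1)] continuous_on_trig_polynomial)
next
  have "\<forall>\<^sub>F F in finite_subsets_at_top UNIV. finite F \<and> K \<subseteq> F"
    using \<open>finite K\<close> by (auto simp: eventually_finite_subsets_at_top)
  then have "\<forall>\<^sub>F F in finite_subsets_at_top UNIV.
      (\<integral>\<^sup>+\<xi>. ennreal ((L2_set (\<lambda>i. norm ((\<Sum>\<gamma>\<in>K. cnj (\<xi> \<gamma>) *\<^sub>C f \<gamma> i)
        - (\<Sum>\<gamma>\<in>F. cnj (\<xi> \<gamma>) *\<^sub>C f \<gamma> i))) I)\<^sup>2) \<partial>\<mu>) = 0"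
  proof eventually_elim
    case (elim F)
    have "(\<Sum>\<gamma>\<in>K. cnj (\<xi> \<gamma>) *\<^sub>C f \<gamma> i) = (\<Sum>\<gamma>\<in>F. cnj (\<xi> \<gamma>) *\<^sub>C f \<gamma> i)" if "i \<in> I" for \<xi> i
      using elim assms(3)[OF that] by (intro sum.mono_neutral_left) auto
    then have "L2_set (\<lambda>i. norm ((\<Sum>\<gamma>\<in>K. cnj (\<xi> \<gamma>) *\<^sub>C f \<gamma> i)
        - (\<Sum>\<gamma>\<in>F. cnj (\<xi> \<gamma>) *\<^sub>C f \<gamma> i))) I = 0" for \<xi>
      by (simp add: L2_set_def cong: sum.cong)
    then show ?case by simp
  qed
  then show "((\<lambda>F. \<integral>\<^sup>+\<xi>. ennreal ((L2_set (\<lambda>i. norm ((\<Sum>\<gamma>\<in>K. cnj (\<xi> \<gamma>) *\<^sub>C f \<gamma> i)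
        - (\<Sum>\<gamma>\<in>F. cnj (\<xi> \<gamma>) *\<^sub>C f \<gamma> i))) I)\<^sup>2) \<partial>\<mu>) \<longlongrightarrow> 0) (finite_subsets_at_top UNIV)"
    by (rule tendsto_eventually)
qed

text \<open>Two representatives of the same transform are within any mean square distance of a
  common partial sum, so their distance is zero.\<close>

lemma has_fourier_unique:
  fixes g h :: "('g :: ab_group_add \<Rightarrow> complex) \<Rightarrow> 'i \<Rightarrow> 'h :: fin_dim_complex_hilbert"
  assumes \<mu>: "haar_prob_dual \<mu>" and I: "finite I"
    and g: "has_fourier \<mu> I f g" and h: "has_fourier \<mu> I f h"
  shows "AE \<xi> in \<mu>. \<forall>i\<in>I. g \<xi> i = h \<xi> i"
proof (intro AE_finite_allI[OF I])
  fix i assume i: "i \<in> I"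
  define S where "S F \<xi> j = (\<Sum>\<gamma>\<in>F. cnj (\<xi> \<gamma>) *\<^sub>C f \<gamma> j)" for F \<xi> j
  have S [measurable]: "(\<lambda>\<xi>. S F \<xi> j) \<in> borel_measurable \<mu>" for F j
    unfolding S_def by (intro continuous_on_dual_group_measurable[OF \<mu>] continuous_on_trig_polynomial)
  have gm: "(\<lambda>\<xi>. g \<xi> j) \<in> borel_measurable \<mu>" and hm: "(\<lambda>\<xi>. h \<xi> j) \<in> borel_measurable \<mu>"
    if "j \<in> I" for j
    using g h that by (auto simp: has_fourier_def)
  note [measurable] = gm[OF i] hm[OF i]
  define R where "R k F \<xi> = ennreal ((norm (k \<xi> i - S F \<xi> i))\<^sup>2)"
    for k :: "('g \<Rightarrow> complex) \<Rightarrow> 'i \<Rightarrow> 'h" and F \<xi>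
  have R_tendsto: "((\<lambda>F. \<integral>\<^sup>+\<xi>. R k F \<xi> \<partial>\<mu>) \<longlongrightarrow> 0) (finite_subsets_at_top UNIV)"
    if k: "has_fourier \<mu> I f k" for k
  proof (rule tendsto_sandwich[OF _ _ tendsto_const])
    show "((\<lambda>F. \<integral>\<^sup>+\<xi>. ennreal ((L2_set (\<lambda>i. norm (k \<xi> i - S F \<xi> i)) I)\<^sup>2) \<partial>\<mu>) \<longlongrightarrow> 0)
        (finite_subsets_at_top UNIV)"
      using k unfolding has_fourier_def S_def by blast
    have "(norm (k \<xi> i - S F \<xi> i))\<^sup>2 \<le> (L2_set (\<lambda>i. norm (k \<xi> i - S F \<xi> i)) I)\<^sup>2" for F \<xi>
      by (intro power_mono member_le_L2_set I i) auto
    then show "\<forall>\<^sub>F F in finite_subsets_at_top UNIV. (\<integral>\<^sup>+\<xi>. R k F \<xi> \<partial>\<mu>)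
        \<le> (\<integral>\<^sup>+\<xi>. ennreal ((L2_set (\<lambda>i. norm (k \<xi> i - S F \<xi> i)) I)\<^sup>2) \<partial>\<mu>)"
      unfolding R_def by (intro always_eventually allI nn_integral_mono ennreal_leI)
  qed auto
  have le: "(\<integral>\<^sup>+\<xi>. ennreal ((norm (g \<xi> i - h \<xi> i))\<^sup>2) \<partial>\<mu>)
      \<le> 2 * ((\<integral>\<^sup>+\<xi>. R g F \<xi> \<partial>\<mu>) + (\<integral>\<^sup>+\<xi>. R h F \<xi> \<partial>\<mu>))" for F
  proof -
    have "ennreal ((norm (g \<xi> i - h \<xi> i))\<^sup>2) \<le> 2 * (R g F \<xi> + R h F \<xi>)" for \<xi>
    proof -
      let ?u = "norm (g \<xi> i - S F \<xi> i)" and ?v = "norm (h \<xi> i - S F \<xi> i)"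
      have "norm (g \<xi> i - h \<xi> i) \<le> ?u + ?v"
        by (metis dist_norm dist_triangle2)
      then have "(norm (g \<xi> i - h \<xi> i))\<^sup>2 \<le> (?u + ?v)\<^sup>2" by (intro power_mono) auto
      also have "\<dots> \<le> 2 * (?u\<^sup>2 + ?v\<^sup>2)"
        using sum_squares_bound[of ?u ?v] by (simp add: power2_sum)
      finally show ?thesis
        unfolding R_def
        by (simp flip: ennreal_plus ennreal_numeral add: ennreal_mult' [symmetric] ennreal_leI)
    qed
    then have "(\<integral>\<^sup>+\<xi>. ennreal ((norm (g \<xi> i - h \<xi> i))\<^sup>2) \<partial>\<mu>) \<le> (\<integral>\<^sup>+\<xi>. 2 * (R g F \<xi> + R h F \<xi>) \<partial>\<mu>)"
      by (intro nn_integral_mono)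
    also have "\<dots> = 2 * ((\<integral>\<^sup>+\<xi>. R g F \<xi> \<partial>\<mu>) + (\<integral>\<^sup>+\<xi>. R h F \<xi> \<partial>\<mu>))"
      unfolding R_def by (simp add: nn_integral_cmult nn_integral_add)
    finally show ?thesis .
  qed
  have "((\<lambda>F. (\<integral>\<^sup>+\<xi>. R g F \<xi> \<partial>\<mu>) + (\<integral>\<^sup>+\<xi>. R h F \<xi> \<partial>\<mu>)) \<longlongrightarrow> 0 + 0) (finite_subsets_at_top UNIV)"
    by (intro tendsto_add R_tendsto g h)
  then have "((\<lambda>F. 2 * ((\<integral>\<^sup>+\<xi>. R g F \<xi> \<partial>\<mu>) + (\<integral>\<^sup>+\<xi>. R h F \<xi> \<partial>\<mu>))) \<longlongrightarrow> 2 * (0 + 0))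
      (finite_subsets_at_top UNIV)"
    by (intro ennreal_tendsto_cmult) auto
  then have "(\<integral>\<^sup>+\<xi>. ennreal ((norm (g \<xi> i - h \<xi> i))\<^sup>2) \<partial>\<mu>) \<le> 2 * (0 + 0)"
    by (rule tendsto_lowerbound) (use le in \<open>simp_all only: eventually_True finite_subsets_at_top_neq_bot not_False_eq_True\<close>)
  then have "(\<integral>\<^sup>+\<xi>. ennreal ((norm (g \<xi> i - h \<xi> i))\<^sup>2) \<partial>\<mu>) = 0" by simp
  then have "AE \<xi> in \<mu>. ennreal ((norm (g \<xi> i - h \<xi> i))\<^sup>2) = 0"
    by (subst (asm) nn_integral_0_iff_AE) auto
  then show "AE \<xi> in \<mu>. g \<xi> i = h \<xi> i" by eventually_elim simp
qed

text \<open>The function chosen as the transform is some representative of its class, and on finitely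
  supported functions the class is that of the evident trigonometric polynomial.\<close>

lemma fourier_finite_support:
  fixes f :: "'g :: ab_group_add \<Rightarrow> 'i \<Rightarrow> 'h :: fin_dim_complex_hilbert"
  assumes "haar_prob_dual \<mu>" and "finite I"
    and "finite K" and "\<And>i \<gamma>. i \<in> I \<Longrightarrow> \<gamma> \<notin> K \<Longrightarrow> f \<gamma> i = 0"
  shows "AE \<xi> in \<mu>. \<forall>i\<in>I. fourier \<mu> I f \<xi> i = (\<Sum>\<gamma>\<in>K. cnj (\<xi> \<gamma>) *\<^sub>C f \<gamma> i)"
proof -
  have *: "has_fourier \<mu> I f (\<lambda>\<xi> i. \<Sum>\<gamma>\<in>K. cnj (\<xi> \<gamma>) *\<^sub>C f \<gamma> i)"
    using assms by (intro has_fourier_finite_support)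
  then have "has_fourier \<mu> I f (fourier \<mu> I f)" unfolding fourier_def by (rule someI[of "has_fourier \<mu> I f"])
  with * show ?thesis using assms by (intro has_fourier_unique)
qed

section \<open>The action on vertices and edges\<close>

context symmetric_framework
begin

lemma theta_in_V: "v \<in> V \<Longrightarrow> \<theta> \<gamma> v \<in> V"
  using theta_bij[of \<gamma>] by (auto dest: bij_betwE)

lemma theta_zero: "v \<in> V \<Longrightarrow> \<theta> 0 v = v"
  using theta_add[of v 0 0] theta_bij[of 0] theta_in_V[of v 0]
  by (metis add_0 bij_betw_imp_inj_on inj_onD)

lemma vorbit_theta:
  assumes "v \<in> V"
  shows "vorbit \<theta> (\<theta> \<gamma> v) = vorbit \<theta> v"
proof -
  have "\<theta> \<beta> v \<in> vorbit \<theta> (\<theta> \<gamma> v)" for \<beta>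
    using theta_add[OF assms, of "\<beta> - \<gamma>" \<gamma>] unfolding vorbit_def by auto
  moreover have "\<theta> \<beta> (\<theta> \<gamma> v) \<in> vorbit \<theta> v" for \<beta>
    using theta_add[OF assms, of \<beta> \<gamma>] unfolding vorbit_def by (metis rangeI)
  ultimately show ?thesis unfolding vorbit_def by blast
qed

lemma theta_image_E:
  assumes "e \<in> E"
  shows "\<theta> \<gamma> ` e \<in> E"
  using edge[OF assms] assms by (auto simp: theta_edge)

lemma theta_image_uminus:
  assumes "e \<in> E"
  shows "\<theta> (- \<gamma>) ` \<theta> \<gamma> ` e = e"
proof -
  have "\<theta> (- \<gamma>) (\<theta> \<gamma> v) = v" if "v \<in> e" for v
    using that edge[OF assms] theta_add[of v "- \<gamma>" \<gamma>] theta_zero[of v] by auto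
  then show ?thesis by (simp add: image_image)
qed

lemma linear_part_tau_add:
  "linear_part (\<tau> (\<gamma> + \<delta>)) x = linear_part (\<tau> \<gamma>) (linear_part (\<tau> \<delta>) x)"
  unfolding tau_add by (rule linear_part_comp[OF tau_isometry])

lemma linear_part_tau_zero: "linear_part (\<tau> 0) x = x"
proof -
  let ?L = "linear_part (\<tau> 0)"
  note L = clinear_simps[OF clinear_linear_part[OF tau_isometry]]
  have "?L (?L x - x) = 0" using linear_part_tau_add[of 0 0 x] by (simp add: L)
  then show ?thesis using norm_linear_part[OF tau_isometry, of 0 "?L x - x"] by simp
qed

end

section \<open>The symbol function in coordinates\<close>

context symmetric_framework_with_gains
begin

lemma rep_in_V: "q \<in> vorbits \<theta> V \<Longrightarrow> r q \<in> V"
  using rep_in[of q] by (auto simp: vorbits_def vorbit_def theta_in_V)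

lemma vorbit_rep:
  assumes "q \<in> vorbits \<theta> V"
  shows "vorbit \<theta> (\<theta> \<gamma> (r q)) = q"
proof -
  obtain v where v: "v \<in> V" "q = vorbit \<theta> v" using assms unfolding vorbits_def by blast
  obtain \<delta> where "r q = \<theta> \<delta> v" using rep_in[OF assms] v(2) unfolding vorbit_def by blast
  then show ?thesis using v by (simp add: vorbit_theta theta_in_V)
qed

lemma rep_edge_in_E: "p \<in> eorbits \<theta> E \<Longrightarrow> rep_edge \<theta> r src tgt gain p \<in> E"
  using rep_edge_in[of p] by (auto simp: eorbits_def eorbit_def theta_image_E)

lemma edge_eq_theta_rep_edge:
  assumes "e \<in> E"
  obtains \<gamma> where "e = \<theta> \<gamma> ` rep_edge \<theta> r src tgt gain (eorbit \<theta> e)"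
proof -
  have "rep_edge \<theta> r src tgt gain (eorbit \<theta> e) \<in> eorbit \<theta> e"
    using assms by (intro rep_edge_in) (simp add: eorbits_def)
  then obtain \<gamma> where "rep_edge \<theta> r src tgt gain (eorbit \<theta> e) = \<theta> \<gamma> ` e"
    by (auto simp: eorbit_def)
  then have "e = \<theta> (- \<gamma>) ` rep_edge \<theta> r src tgt gain (eorbit \<theta> e)"
    by (simp add: theta_image_uminus[OF assms])
  then show ?thesis by (rule that)
qed

lemma vertex_eq_theta_rep:
  assumes "v \<in> V"
  obtains \<gamma> where "v = \<theta> \<gamma> (r (vorbit \<theta> v))"
proof -
  have "r (vorbit \<theta> v) \<in> vorbit \<theta> v" using assms by (intro rep_in) (simp add: vorbits_def)
  then obtain \<gamma> where "r (vorbit \<theta> v) = \<theta> \<gamma> v" by (auto simp: vorbit_def)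
  then have "v = \<theta> (- \<gamma>) (r (vorbit \<theta> v))"
    using theta_add[OF assms, of "- \<gamma>" \<gamma>] theta_zero[OF assms] by simp
  then show ?thesis by (rule that)
qed

abbreviation rep_phi :: "'v set set \<Rightarrow> 'x \<Rightarrow> 'y" where
  "rep_phi p \<equiv> \<phi> (r (src p)) (\<theta> (gain p) (r (tgt p)))"

lemma clinear_rep_phi: "p \<in> eorbits \<theta> E \<Longrightarrow> clinear (rep_phi p)"
  by (intro phi_linear theta_in_V rep_in_V src_in tgt_in)

text \<open>Equivariance reduces the coboundary on any translate of a representative edge to the one
  linear map that belongs to that edge.\<close>

lemma coboundary_translate:
  assumes p: "p \<in> eorbits \<theta> E"
  shows "coboundary \<phi> x (\<theta> \<gamma> ` rep_edge \<theta> r src tgt gain p) =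
    rep_phi p (linear_part (\<tau> (- \<gamma>)) (x (\<theta> \<gamma> (r (src p))) - x (\<theta> (\<gamma> + gain p) (r (tgt p)))))"
proof -
  let ?v = "r (src p)" and ?w = "r (tgt p)"
  have V: "?v \<in> V" "?w \<in> V" by (intro rep_in_V src_in tgt_in p)+
  have eq: "\<theta> \<gamma> ` rep_edge \<theta> r src tgt gain p = {\<theta> \<gamma> ?v, \<theta> \<gamma> (\<theta> (gain p) ?w)}"
    by (simp add: rep_edge_def)
  have "{\<theta> \<gamma> ?v, \<theta> \<gamma> (\<theta> (gain p) ?w)} \<in> E"
    using theta_image_E[OF rep_edge_in_E[OF p], of \<gamma>] by (simp only: eq)
  from coboundary_edge[OF this] show ?thesis
    unfolding eq by (simp add: phi_equivariant V theta_in_V theta_add)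
qed

text \<open>This is the product of the explicit symbol matrix at \<open>\<xi>\<close> with \<open>a\<close>. For the representative
  edge from \<open>v\<close> to \<open>\<gamma> w\<close>, equivariance identifies \<open>\<phi> v (\<gamma> w)\<close> composed with the linear part of
  \<open>\<tau> \<gamma>\<close> with \<open>\<phi> (- \<gamma> v) w = - \<phi> w (- \<gamma> v)\<close>, which accounts for the sign. Written this way, loops
  are not a separate case: their two contributions to the same column simply add up.\<close>

definition symbol_row :: "('g \<Rightarrow> complex) \<Rightarrow> ('v set \<Rightarrow> 'x) \<Rightarrow> 'v set set \<Rightarrow> 'y" where
  "symbol_row \<xi> a p = rep_phi p (a (src p))
     - \<xi> (gain p) *\<^sub>C rep_phi p (linear_part (\<tau> (gain p)) (a (tgt p)))"

lemma continuous_on_symbol_row: "continuous_on S (\<lambda>\<xi>. symbol_row \<xi> a p)"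
  unfolding symbol_row_def
  by (intro continuous_on_diff continuous_on_const continuous_on_scaleC_left continuous_on_eval)

text \<open>Moving by \<open>\<gamma>\<close> changes the values of \<open>z(\<xi>, a)\<close> by \<open>\<xi> \<gamma>\<close> and the linear part of \<open>\<tau> \<gamma>\<close>; the
  latter cancels against the linear part of \<open>\<tau> (- \<gamma>)\<close> from the equivariance of \<open>\<phi>\<close>. So one row of
  the symbol determines the coboundary on a whole edge orbit.\<close>

lemma coboundary_character_vector:
  assumes p: "p \<in> eorbits \<theta> E" and \<xi>: "\<xi> \<in> dual_group"
  shows "coboundary \<phi> (character_vector \<theta> \<tau> r \<xi> a) (\<theta> \<gamma> ` rep_edge \<theta> r src tgt gain p) =
    \<xi> \<gamma> *\<^sub>C symbol_row \<xi> a p"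
proof -
  let ?L = "\<lambda>\<gamma>. linear_part (\<tau> \<gamma>)"
  note L = clinear_simps[OF clinear_linear_part[OF tau_isometry]]
  note P = clinear_simps[OF clinear_rep_phi[OF p]]
  have "?L (- \<gamma>) (\<xi> \<gamma> *\<^sub>C ?L \<gamma> (a (src p))
        - \<xi> (\<gamma> + gain p) *\<^sub>C ?L (\<gamma> + gain p) (a (tgt p))) =
      \<xi> \<gamma> *\<^sub>C a (src p) - \<xi> (\<gamma> + gain p) *\<^sub>C ?L (gain p) (a (tgt p))"
    by (simp add: L linear_part_tau_zero flip: linear_part_tau_add)
  then show ?thesis
    unfolding coboundary_translate[OF p] character_vector_rep[OF src_in[OF p]]
      character_vector_rep[OF tgt_in[OF p]]
    by (simp add: symbol_row_def P dual_group_add[OF \<xi>] complex_vector.scale_right_diff_distrib)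
qed

text \<open>This is the test vector: as a function on the group with values in the direct sum over the
  vertex orbits, it is \<open>a\<close> at \<open>0\<close> and vanishes elsewhere.\<close>

definition rep_vector :: "('v set \<Rightarrow> 'x) \<Rightarrow> 'v \<Rightarrow> 'x" where
  "rep_vector a v = (if v = r (vorbit \<theta> v) then a (vorbit \<theta> v) else 0)"

lemma rep_vector_rep:
  assumes "q \<in> vorbits \<theta> V"
  shows "rep_vector a (\<theta> \<gamma> (r q)) = (if \<gamma> = 0 then a q else 0)"
  using free_vertices[OF rep_in_V[OF assms], of \<gamma>] theta_zero[OF rep_in_V[OF assms]]
  using vorbit_rep[OF assms, of 0] by (auto simp: rep_vector_def vorbit_rep[OF assms])

lemma rep_vector_summable: "(\<lambda>v. (norm (rep_vector a v))\<^sup>2) summable_on V"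
proof (rule finite_nonzero_values_imp_summable_on)
  have "{v \<in> V. (norm (rep_vector a v))\<^sup>2 \<noteq> 0} \<subseteq> r ` vorbits \<theta> V"
    by (auto simp: rep_vector_def vorbits_def split: if_splits)
  then show "finite {v \<in> V. (norm (rep_vector a v))\<^sup>2 \<noteq> 0}"
    using finite_vorbits finite_subset by blast
qed

lemma fourier_rep_vector:
  assumes "haar_prob_dual \<mu>"
  shows "AE \<xi> in \<mu>. \<forall>q\<in>vorbits \<theta> V.
    fourier \<mu> (vorbits \<theta> V) (T_tau \<tau> (S_V \<theta> r (rep_vector a))) \<xi> q = a q"
proof -
  let ?f = "T_tau \<tau> (S_V \<theta> r (rep_vector a))"
  note L = clinear_simps[OF clinear_linear_part[OF tau_isometry]]
  have f: "?f \<gamma> q = (if \<gamma> = 0 then a q else 0)" if "q \<in> vorbits \<theta> V" for \<gamma> q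
    by (simp add: T_tau_def S_V_def rep_vector_rep[OF that] linear_part_tau_zero L)
  have "AE \<xi> in \<mu>. \<xi> \<in> dual_group" using haar_space[OF assms] AE_space[of \<mu>] by simp
  moreover have "AE \<xi> in \<mu>. \<forall>q\<in>vorbits \<theta> V.
      fourier \<mu> (vorbits \<theta> V) ?f \<xi> q = (\<Sum>\<gamma>\<in>{0}. cnj (\<xi> \<gamma>) *\<^sub>C ?f \<gamma> q)"
    by (rule fourier_finite_support[OF assms finite_vorbits]) (auto simp: f)
  ultimately show ?thesis by eventually_elim (simp add: f dual_group_zero)
qed

lemma fourier_coboundary_rep_vector:
  assumes "haar_prob_dual \<mu>"
  shows "AE \<xi> in \<mu>. \<forall>p\<in>eorbits \<theta> E. fourier \<mu> (eorbits \<theta> E)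
    (S_E \<theta> (rep_edge \<theta> r src tgt gain) (coboundary \<phi> (rep_vector a))) \<xi> p = symbol_row \<xi> a p"
proof -
  let ?f = "S_E \<theta> (rep_edge \<theta> r src tgt gain) (coboundary \<phi> (rep_vector a))"
  note L = clinear_simps[OF clinear_linear_part[OF tau_isometry]]
  \<comment> \<open>The coefficient at \<open>\<gamma>\<close> sees the support of the test vector at the source if \<open>\<gamma> = 0\<close>, and
    at the target if \<open>\<gamma> + gain p = 0\<close>.\<close>
  have f: "?f \<gamma> p = (if \<gamma> = 0 then rep_phi p (a (src p)) else 0)
      - (if \<gamma> = - gain p then rep_phi p (linear_part (\<tau> (gain p)) (a (tgt p))) else 0)"
    if p: "p \<in> eorbits \<theta> E" for \<gamma> p
    by (simp add: S_E_def coboundary_translate[OF p] rep_vector_rep src_in tgt_in p L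
        clinear_simps[OF clinear_rep_phi[OF p]] linear_part_tau_zero add_eq_0_iff2)
  \<comment> \<open>This set carries the coefficients for all edge orbits at once.\<close>
  define K where "K = insert 0 ((\<lambda>p. - gain p) ` eorbits \<theta> E)"
  have K: "finite K" unfolding K_def using finite_eorbits by simp
  have "(\<Sum>\<gamma>\<in>K. cnj (\<xi> \<gamma>) *\<^sub>C ?f \<gamma> p) = symbol_row \<xi> a p"
    if p: "p \<in> eorbits \<theta> E" and \<xi>: "\<xi> \<in> dual_group" for p \<xi>
  proof -
    have "(\<Sum>\<gamma>\<in>K. cnj (\<xi> \<gamma>) *\<^sub>C ?f \<gamma> p) =
        (\<Sum>\<gamma>\<in>K. (if \<gamma> = 0 then rep_phi p (a (src p)) else 0)
          - (if \<gamma> = - gain p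
             then \<xi> (gain p) *\<^sub>C rep_phi p (linear_part (\<tau> (gain p)) (a (tgt p))) else 0))"
      by (intro sum.cong)
        (auto simp: f[OF p] complex_vector.scale_right_diff_distrib dual_group_zero[OF \<xi>]
          dual_group_uminus[OF \<xi>])
    also have "\<dots> = symbol_row \<xi> a p"
      using K p by (simp add: sum_subtractf symbol_row_def) (simp add: K_def)
    finally show ?thesis .
  qed
  moreover have "AE \<xi> in \<mu>. \<forall>p\<in>eorbits \<theta> E.
      fourier \<mu> (eorbits \<theta> E) ?f \<xi> p = (\<Sum>\<gamma>\<in>K. cnj (\<xi> \<gamma>) *\<^sub>C ?f \<gamma> p)"
    by (rule fourier_finite_support[OF assms finite_eorbits K]) (auto simp: f K_def)
  moreover have "AE \<xi> in \<mu>. \<xi> \<in> dual_group" using haar_space[OF assms] AE_space[of \<mu>] by simp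
  ultimately show ?thesis by (auto elim: eventually_elim2)
qed

lemma continuous_on_symbol_function:
  assumes "is_symbol_function V E \<phi> \<theta> \<tau> r src tgt gain \<mu> \<Phi>" and p: "p \<in> eorbits \<theta> E"
  shows "continuous_on dual_group (\<lambda>\<xi>. \<Phi> \<xi> a p)"
  unfolding continuous_on_def
proof (intro ballI tendstoI)
  fix \<xi> :: "'g \<Rightarrow> complex" and e :: real
  assume \<xi>: "\<xi> \<in> dual_group" and e: "e > 0"
  let ?A = "L2_set (\<lambda>q. norm (a q)) (vorbits \<theta> V)"
  have A: "?A \<ge> 0" by (rule L2_set_nonneg)
  then have "e / (?A + 1) > 0" using e by (intro divide_pos_pos) linarith+
  then have "\<forall>\<^sub>F \<psi> in at \<xi> within dual_group.
      L2_set (\<lambda>p. norm (\<Phi> \<psi> a p - \<Phi> \<xi> a p)) (eorbits \<theta> E) \<le> e / (?A + 1) * ?A"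
    using assms(1) \<xi> unfolding is_symbol_function_def by (blast intro: eventually_mono)
  then show "\<forall>\<^sub>F \<psi> in at \<xi> within dual_group. dist (\<Phi> \<psi> a p) (\<Phi> \<xi> a p) < e"
  proof eventually_elim
    case (elim \<psi>)
    have "norm (\<Phi> \<psi> a p - \<Phi> \<xi> a p) \<le> L2_set (\<lambda>p. norm (\<Phi> \<psi> a p - \<Phi> \<xi> a p)) (eorbits \<theta> E)"
      by (intro member_le_L2_set finite_eorbits p)
    also have "\<dots> \<le> e / (?A + 1) * ?A" by (rule elim)
    also have "\<dots> < e / (?A + 1) * (?A + 1)"
      by (rule mult_strict_left_mono[OF _ \<open>e / (?A + 1) > 0\<close>]) simp
    also have "\<dots> = e" using A by (simp add: add_nonneg_eq_0_iff)
    finally show ?case by (simp add: dist_norm)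
  qed
qed

text \<open>The factorisation applied to the test vector yields the formula for almost every character
  only; continuity of both sides and the full support of Haar measure extend it to every single
  one.\<close>

lemma symbol_function_eq_symbol_row:
  assumes \<mu>: "haar_prob_dual \<mu>"
    and \<Phi>: "is_symbol_function V E \<phi> \<theta> \<tau> r src tgt gain \<mu> \<Phi>"
    and p: "p \<in> eorbits \<theta> E" and \<xi>: "\<xi> \<in> dual_group"
  shows "\<Phi> \<xi> a p = symbol_row \<xi> a p"
proof (rule continuous_AE_eq_imp_eq[OF \<mu> continuous_on_symbol_function[OF \<Phi> p]
      continuous_on_symbol_row _ \<xi>])
  let ?F = "fourier \<mu> (vorbits \<theta> V) (T_tau \<tau> (S_V \<theta> r (rep_vector a)))"
  have "AE \<xi> in \<mu>. \<forall>p\<in>eorbits \<theta> E. fourier \<mu> (eorbits \<theta> E)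
      (S_E \<theta> (rep_edge \<theta> r src tgt gain) (coboundary \<phi> (rep_vector a))) \<xi> p = \<Phi> \<xi> (?F \<xi>) p"
    using \<Phi> rep_vector_summable[of a] unfolding is_symbol_function_def by blast
  moreover note fourier_rep_vector[OF \<mu>, of a] fourier_coboundary_rep_vector[OF \<mu>, of a]
  moreover have "AE \<xi> in \<mu>. \<xi> \<in> dual_group" using haar_space[OF \<mu>] AE_space[of \<mu>] by simp
  ultimately show "AE \<xi> in \<mu>. \<Phi> \<xi> a p = symbol_row \<xi> a p"
  proof eventually_elim
    case (elim \<psi>)
    have "sum_operator (vorbits \<theta> V) (eorbits \<theta> E) (\<Phi> \<psi>)"
      using \<Phi> elim(4) unfolding is_symbol_function_def by blast
    then have "\<Phi> \<psi> (?F \<psi>) p = \<Phi> \<psi> a p"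
      using elim(2) p unfolding sum_operator_def by blast
    then show ?case using elim(1,3) p by simp
  qed
qed

lemma bounded_character_vector:
  assumes \<xi>: "\<xi> \<in> dual_group"
  shows "bounded (character_vector \<theta> \<tau> r \<xi> a ` V)"
proof -
  have "norm (character_vector \<theta> \<tau> r \<xi> a v) \<le> Max ((\<lambda>q. norm (a q)) ` vorbits \<theta> V)"
    if v: "v \<in> V" for v
  proof -
    have q: "vorbit \<theta> v \<in> vorbits \<theta> V" using v by (simp add: vorbits_def)
    obtain \<gamma> where "v = \<theta> \<gamma> (r (vorbit \<theta> v))" using v by (rule vertex_eq_theta_rep)
    then have "norm (character_vector \<theta> \<tau> r \<xi> a v) = norm (a (vorbit \<theta> v))"
      using character_vector_rep[OF q, of \<xi> a \<gamma>]
      by (simp add: norm_scaleC dual_group_norm[OF \<xi>] norm_linear_part[OF tau_isometry])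
    then show ?thesis using q finite_vorbits by simp
  qed
  then show ?thesis by (auto simp: bounded_iff)
qed

end

theorem theorem4p1:
  fixes V :: "'v set" and E :: "'v set set"
    and \<phi> :: "'v \<Rightarrow> 'v \<Rightarrow> 'x :: fin_dim_complex_hilbert \<Rightarrow> 'y :: fin_dim_complex_hilbert"
    and \<theta> :: "'g :: ab_group_add \<Rightarrow> 'v \<Rightarrow> 'v"
    and \<tau> :: "'g \<Rightarrow> 'x \<Rightarrow> 'x"
    and r :: "'v set \<Rightarrow> 'v"
    and src tgt :: "'v set set \<Rightarrow> 'v set"
    and gain :: "'v set set \<Rightarrow> 'g"
    and \<mu> :: "('g \<Rightarrow> complex) measure"
    and \<Phi> :: "('g \<Rightarrow> complex) \<Rightarrow> ('v set \<Rightarrow> 'x) \<Rightarrow> 'v set set \<Rightarrow> 'y"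
    and \<xi> :: "'g \<Rightarrow> complex"
    and a :: "'v set \<Rightarrow> 'x"
  assumes "symmetric_framework_with_gains V E \<phi> \<theta> \<tau> r src tgt gain"
    and "haar_prob_dual \<mu>"
    and "is_symbol_function V E \<phi> \<theta> \<tau> r src tgt gain \<mu> \<Phi>"
    and "\<xi> \<in> dual_group"
  shows "bounded (character_vector \<theta> \<tau> r \<xi> a ` V) \<and>
    ((\<forall>p\<in>eorbits \<theta> E. \<Phi> \<xi> a p = 0) \<longrightarrow>
     (\<forall>e\<in>E. coboundary \<phi> (character_vector \<theta> \<tau> r \<xi> a) e = 0))"
proof -
  interpret symmetric_framework_with_gains V E \<phi> \<theta> \<tau> r src tgt gain by (rule assms(1))
  have "coboundary \<phi> (character_vector \<theta> \<tau> r \<xi> a) e = 0"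
    if ker: "\<forall>p\<in>eorbits \<theta> E. \<Phi> \<xi> a p = 0" and e: "e \<in> E" for e
  proof -
    have p: "eorbit \<theta> e \<in> eorbits \<theta> E" using e by (simp add: eorbits_def)
    obtain \<gamma> where \<gamma>: "e = \<theta> \<gamma> ` rep_edge \<theta> r src tgt gain (eorbit \<theta> e)"
      using e by (rule edge_eq_theta_rep_edge)
    have "coboundary \<phi> (character_vector \<theta> \<tau> r \<xi> a) e = \<xi> \<gamma> *\<^sub>C symbol_row \<xi> a (eorbit \<theta> e)"
      by (subst \<gamma>) (rule coboundary_character_vector[OF p assms(4)])
    also have "symbol_row \<xi> a (eorbit \<theta> e) = 0"
      using symbol_function_eq_symbol_row[OF assms(2,3) p assms(4), of a] ker p by simp
    finally show ?thesis by simp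
  qed
  then show ?thesis using bounded_character_vector[OF assms(4)] by blast
qed

end
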